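(* Let $(L,[\,,\,],\alpha)$ be a Hom-Lie superalgebra over $F$ and let $U$ and $W$ be Hom-Lie ideals of $L$ with $L=U\oplus W$. Then $L$ is restrictable if and only if $U$ and $W$ (with the restricted bracket and restricted $\alpha$) are restrictable.
   Context: $F$ is a field of characteristic $p>0$ with $p\neq 2,3$. A linear superspace is a $\mathbb{Z}_2$-graded $F$-vector space $V=V_0\oplus V_1$; $|x|$ denotes the parity of a homogeneous element $x$; a linear map $V\to V'$ is even if it maps $V_j$ into $V'_j$ for $j=0,1$, and a bilinear map is even if it respects the grading. A Hom-Lie superalgebra is a triple $(L,[\,,\,],\alpha)$ with $L$ a linear superspace, $[\,,\,]:L\times L\to L$ an even bilinear map and $\alpha:L\to L$ an even linear map such that for all homogeneous $x,y,z$: $[x,y]=-(-1)^{|x||y|}[y,x]$ and $(-1)^{|x||z|}[\alpha(x),[y,z]]+(-1)^{|z||y|}[\alpha(z),[x,y]]+(-1)^{|y||x|}[\alpha(y),[z,x]]=0$. It is multiplicative if $\alpha([x,y])=[\alpha(x),\alpha(y)]$ for all $x,y$. A (graded) subspace $U$ of $L$ is a Hom-Lie ideal if $\alpha(U)\subseteq U$ and $[x,y]\in U$ for all $x\in U$, $y\in L$. One writes $L=U\oplus W$ for subspaces $U,W$ if $L=U+W$ and $U\cap W=\{0\}$. For a multiplicative Hom-Lie superalgebra $L$ put $L^0=\{x\in L_0:\alpha(x)=x\}$, and for $a\in L^0$ let $\mathrm{ad}_\alpha a:L\to L$, $b\mapsto[a,\alpha(b)]$. A Hom-Lie superalgebra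 $(L,[\,,\,],\alpha)$ is restrictable if it is multiplicative and $(\mathrm{ad}_\alpha x)^p\in\mathrm{ad}_\alpha L^0$ for all $x\in L^0$, where $\mathrm{ad}_\alpha L^0=\{\mathrm{ad}_\alpha x:x\in L^0\}$. *)

theory Defs
  imports
    "HOL-Computational_Algebra.Computational_Algebra"
    "HOL-Library.Z2"
    "HOL-Library.FuncSet"
begin

text \<open>
  Superspaces live on subsets of an ambient vector space, so that ideals can be regarded as
  algebras of their own. A grading is a family \<open>G\<close> of subsets indexed by the parities
  \<open>0, 1\<close> of type \<^typ>\<open>bit\<close>; the superspace itself is \<open>superspace_carrier G\<close>.
  The bracket and the twist \<open>\<alpha>\<close> are total functions on the ambient type, of which only
  the values on the carrier matter.
\<close>

definition superspace_carrier :: "(bit \<Rightarrow> 'v::ab_group_add set) \<Rightarrow> 'v set" where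
  "superspace_carrier G = {a + b |a b. a \<in> G 0 \<and> b \<in> G 1}"

locale superspace = vector_space scale
  for scale :: "'f::field \<Rightarrow> 'v::ab_group_add \<Rightarrow> 'v" +
  fixes G :: "bit \<Rightarrow> 'v set"
  assumes subspace_grade: "subspace (G i)"
    and grade_disjoint: "G 0 \<inter> G 1 = {0}"

text \<open>\<open>parity_sign e\<close> is $(-1)^e$; exponents such as $|x||y|$ are computed modulo 2.\<close>

definition parity_sign :: "bit \<Rightarrow> 'f::field" where
  "parity_sign e = (if e = 1 then - 1 else 1)"

locale hom_lie_superalgebra = superspace scale G
  for scale :: "'f::field \<Rightarrow> 'v::ab_group_add \<Rightarrow> 'v" and G :: "bit \<Rightarrow> 'v set" +
  fixes bracket :: "'v \<Rightarrow> 'v \<Rightarrow> 'v"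
    and \<alpha> :: "'v \<Rightarrow> 'v"
  assumes bracket_add_left:
      "\<lbrakk>x \<in> superspace_carrier G; y \<in> superspace_carrier G; z \<in> superspace_carrier G\<rbrakk>
        \<Longrightarrow> bracket (x + y) z = bracket x z + bracket y z"
    and bracket_add_right:
      "\<lbrakk>x \<in> superspace_carrier G; y \<in> superspace_carrier G; z \<in> superspace_carrier G\<rbrakk>
        \<Longrightarrow> bracket x (y + z) = bracket x y + bracket x z"
    and bracket_scale_left:
      "\<lbrakk>x \<in> superspace_carrier G; y \<in> superspace_carrier G\<rbrakk>
        \<Longrightarrow> bracket (scale c x) y = scale c (bracket x y)"
    and bracket_scale_right:
      "\<lbrakk>x \<in> superspace_carrier G; y \<in> superspace_carrier G\<rbrakk>
        \<Longrightarrow> bracket x (scale c y) = scale c (bracket x y)"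
    and bracket_even: "\<lbrakk>x \<in> G i; y \<in> G j\<rbrakk> \<Longrightarrow> bracket x y \<in> G (i + j)"
    and twist_add:
      "\<lbrakk>x \<in> superspace_carrier G; y \<in> superspace_carrier G\<rbrakk> \<Longrightarrow> \<alpha> (x + y) = \<alpha> x + \<alpha> y"
    and twist_scale: "x \<in> superspace_carrier G \<Longrightarrow> \<alpha> (scale c x) = scale c (\<alpha> x)"
    and twist_even: "x \<in> G i \<Longrightarrow> \<alpha> x \<in> G i"
    and super_skew_symmetry:
      "\<lbrakk>x \<in> G i; y \<in> G j\<rbrakk> \<Longrightarrow> bracket x y = - scale (parity_sign (i * j)) (bracket y x)"
    and hom_super_jacobi:
      "\<lbrakk>x \<in> G i; y \<in> G j; z \<in> G k\<rbrakk> \<Longrightarrow>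
          scale (parity_sign (i * k)) (bracket (\<alpha> x) (bracket y z))
        + scale (parity_sign (k * j)) (bracket (\<alpha> z) (bracket x y))
        + scale (parity_sign (j * i)) (bracket (\<alpha> y) (bracket z x)) = 0"

locale multiplicative_hom_lie_superalgebra = hom_lie_superalgebra +
  assumes multiplicative:
    "\<lbrakk>x \<in> superspace_carrier G; y \<in> superspace_carrier G\<rbrakk>
      \<Longrightarrow> \<alpha> (bracket x y) = bracket (\<alpha> x) (\<alpha> y)"

definition sub_grading :: "(bit \<Rightarrow> 'v set) \<Rightarrow> 'v set \<Rightarrow> bit \<Rightarrow> 'v set" where
  "sub_grading G U = (\<lambda>i. U \<inter> G i)"

text \<open>The last conjunct of \<open>graded_subspace\<close> says that \<open>U\<close> contains the homogeneous
  components of its elements.\<close>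

definition graded_subspace ::
  "('f::field \<Rightarrow> 'v::ab_group_add \<Rightarrow> 'v) \<Rightarrow> (bit \<Rightarrow> 'v set) \<Rightarrow> 'v set \<Rightarrow> bool" where
  "graded_subspace scale G U \<longleftrightarrow>
    module.subspace scale U \<and> U \<subseteq> superspace_carrier G \<and> U = superspace_carrier (sub_grading G U)"

definition hom_lie_ideal ::
  "('f::field \<Rightarrow> 'v::ab_group_add \<Rightarrow> 'v) \<Rightarrow> (bit \<Rightarrow> 'v set) \<Rightarrow> ('v \<Rightarrow> 'v \<Rightarrow> 'v)
    \<Rightarrow> ('v \<Rightarrow> 'v) \<Rightarrow> 'v set \<Rightarrow> bool" where
  "hom_lie_ideal scale G bracket \<alpha> U \<longleftrightarrow>
    graded_subspace scale G U \<and> \<alpha> ` U \<subseteq> U \<and>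
    (\<forall>x\<in>U. \<forall>y\<in>superspace_carrier G. bracket x y \<in> U)"

definition is_direct_sum :: "'v::ab_group_add set \<Rightarrow> 'v set \<Rightarrow> 'v set \<Rightarrow> bool" where
  "is_direct_sum L U W \<longleftrightarrow> L = {u + w |u w. u \<in> U \<and> w \<in> W} \<and> U \<inter> W = {0}"

definition even_fixed_points :: "(bit \<Rightarrow> 'v set) \<Rightarrow> ('v \<Rightarrow> 'v) \<Rightarrow> 'v set" where
  "even_fixed_points G \<alpha> = {x \<in> G 0. \<alpha> x = x}"

definition ad_twisted ::
  "(bit \<Rightarrow> 'v::ab_group_add set) \<Rightarrow> ('v \<Rightarrow> 'v \<Rightarrow> 'v) \<Rightarrow> ('v \<Rightarrow> 'v) \<Rightarrow> 'v \<Rightarrow> 'v \<Rightarrow> 'v" where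
  "ad_twisted G bracket \<alpha> a = (\<lambda>b\<in>superspace_carrier G. bracket a (\<alpha> b))"

text \<open>Maps on the carrier are compared as extensional functions. The iterate has to be
  restricted once more, since it need not be \<^const>\<open>undefined\<close> outside the carrier.\<close>

definition restrictable ::
  "('f::field \<Rightarrow> 'v::ab_group_add \<Rightarrow> 'v) \<Rightarrow> (bit \<Rightarrow> 'v set) \<Rightarrow> ('v \<Rightarrow> 'v \<Rightarrow> 'v)
    \<Rightarrow> ('v \<Rightarrow> 'v) \<Rightarrow> bool" where
  "restrictable scale G bracket \<alpha> \<longleftrightarrow>
    multiplicative_hom_lie_superalgebra scale G bracket \<alpha> \<and>
    (\<forall>x\<in>even_fixed_points G \<alpha>.
      restrict (ad_twisted G bracket \<alpha> x ^^ CHAR('f)) (superspace_carrier G)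
        \<in> ad_twisted G bracket \<alpha> ` even_fixed_points G \<alpha>)"

end

theory Submission
  imports Defs
begin

text \<open>
  Since \<open>[U, W] \<subseteq> U \<inter> W = 0\<close>, the bracket and the twist act componentwise on
  \<open>L = U \<oplus> W\<close>. Hence \<open>L\<^sup>0 = U\<^sup>0 \<oplus> W\<^sup>0\<close> and the powers of
  \<open>ad (u + w)\<close> restrict on \<open>U\<close> to those of \<open>ad u\<close> and on \<open>W\<close> to those of
  \<open>ad w\<close>. A witness \<open>y\<close> for \<open>(ad (u + w))\<^sup>p = ad y\<close> in \<open>L\<close> is therefore the same as a pair of
  witnesses, its components, in \<open>U\<close> and \<open>W\<close>.
\<close>

section \<open>Closure of the carrier under the operations\<close>

context hom_lie_superalgebra
begin

abbreviation L :: "'v set" where "L \<equiv> superspace_carrier G"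

lemma grade_subset_carrier: "x \<in> G i \<Longrightarrow> x \<in> L"
proof (cases "i = 0")
  case True
  assume "x \<in> G i"
  then show ?thesis
    using True subspace_0[OF subspace_grade[of 1]] unfolding superspace_carrier_def by force
next
  case False
  then have "i = 1" by simp
  assume "x \<in> G i"
  then show ?thesis
    using \<open>i = 1\<close> subspace_0[OF subspace_grade[of 0]] unfolding superspace_carrier_def by force
qed

lemma carrierE:
  assumes "x \<in> L"
  obtains a b where "x = a + b" "a \<in> G 0" "b \<in> G 1"
  using assms unfolding superspace_carrier_def by blast

lemma subspace_carrier: "subspace L"
  using subspace_sums[OF subspace_grade[of 0] subspace_grade[of 1]]
  unfolding superspace_carrier_def .

lemma carrier_add: "x \<in> L \<Longrightarrow> y \<in> L \<Longrightarrow> x + y \<in> L"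
  by (rule subspace_add[OF subspace_carrier])

lemma twist_carrier: "x \<in> L \<Longrightarrow> \<alpha> x \<in> L"
  by (metis carrierE grade_subset_carrier twist_add twist_even carrier_add)

lemma bracket_carrier:
  assumes "x \<in> L" "y \<in> L"
  shows "bracket x y \<in> L"
proof -
  obtain a b where x: "x = a + b" "a \<in> G 0" "b \<in> G 1" using assms(1) by (rule carrierE)
  obtain c d where y: "y = c + d" "c \<in> G 0" "d \<in> G 1" using assms(2) by (rule carrierE)
  have "bracket x y = (bracket a c + bracket a d) + (bracket b c + bracket b d)"
    using x y by (simp add: bracket_add_left bracket_add_right grade_subset_carrier carrier_add)
  also have "\<dots> \<in> L"
    using x y by (intro carrier_add grade_subset_carrier[OF bracket_even])
  finally show ?thesis .
qed

section \<open>Hom-Lie ideals as algebras of their own\<close>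

lemma ideal_subspace: "hom_lie_ideal scale G bracket \<alpha> I \<Longrightarrow> subspace I"
  and ideal_subset: "hom_lie_ideal scale G bracket \<alpha> I \<Longrightarrow> x \<in> I \<Longrightarrow> x \<in> L"
  and ideal_carrier: "hom_lie_ideal scale G bracket \<alpha> I \<Longrightarrow> superspace_carrier (sub_grading G I) = I"
  and ideal_twist: "hom_lie_ideal scale G bracket \<alpha> I \<Longrightarrow> x \<in> I \<Longrightarrow> \<alpha> x \<in> I"
  and ideal_bracket_left: "hom_lie_ideal scale G bracket \<alpha> I \<Longrightarrow> x \<in> I \<Longrightarrow> y \<in> L \<Longrightarrow> bracket x y \<in> I"
  unfolding hom_lie_ideal_def graded_subspace_def by auto

lemma idealE:
  assumes "hom_lie_ideal scale G bracket \<alpha> I" "x \<in> I"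
  obtains a b where "x = a + b" "a \<in> I" "b \<in> I" "a \<in> G 0" "b \<in> G 1"
proof -
  have "x \<in> superspace_carrier (sub_grading G I)" using ideal_carrier[OF assms(1)] assms(2) by simp
  then show ?thesis using that unfolding superspace_carrier_def sub_grading_def by auto
qed

text \<open>Ideals are defined by absorption from the left slot only. Super skew-symmetry turns this
  into absorption from the right slot, but it applies to homogeneous elements, so both arguments are
  split first; gradedness of \<open>I\<close> keeps the components of \<open>y\<close> inside
  \<open>I\<close>.\<close>

lemma ideal_bracket_right:
  assumes I: "hom_lie_ideal scale G bracket \<alpha> I" and "x \<in> L" "y \<in> I"
  shows "bracket x y \<in> I"
proof -
  note sub = ideal_subspace[OF I]
  obtain a b where x: "x = a + b" "a \<in> G 0" "b \<in> G 1" using \<open>x \<in> L\<close> by (rule carrierE)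
  obtain c d where y: "y = c + d" "c \<in> I" "d \<in> I" "c \<in> G 0" "d \<in> G 1"
    using I \<open>y \<in> I\<close> by (rule idealE)
  have homogeneous: "bracket s t \<in> I" if "s \<in> G i" "t \<in> I" "t \<in> G j" for s t i j
    unfolding super_skew_symmetry[OF that(1,3)]
    using that by (intro subspace_neg[OF sub] subspace_scale[OF sub] ideal_bracket_left[OF I]
        grade_subset_carrier)
  have "bracket x y = (bracket a c + bracket a d) + (bracket b c + bracket b d)"
    using x y by (simp add: bracket_add_left bracket_add_right grade_subset_carrier carrier_add)
  also have "\<dots> \<in> I"
    using x y by (intro subspace_add[OF sub]) (auto intro: homogeneous)
  finally show ?thesis .
qed

text \<open>All identities are inherited from the larger algebra. What the ideal property supplies
  is that bracket and twist stay inside \<open>I\<close>, while gradedness makes \<open>I\<close>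
  itself the carrier of \<open>sub_grading G I\<close>.\<close>

lemma hom_lie_superalgebra_ideal:
  assumes I: "hom_lie_ideal scale G bracket \<alpha> I"
  shows "hom_lie_superalgebra scale (sub_grading G I) bracket \<alpha>"
proof -
  have "superspace scale (sub_grading G I)"
  proof unfold_locales
    show "subspace (sub_grading G I i)" for i
      unfolding sub_grading_def
      using subspace_inter[OF ideal_subspace[OF I] subspace_grade] .
    show "sub_grading G I 0 \<inter> sub_grading G I 1 = {0}"
      using grade_disjoint subspace_0[OF ideal_subspace[OF I]] unfolding sub_grading_def by blast
  qed
  moreover have mem: "x \<in> sub_grading G I i \<longleftrightarrow> x \<in> I \<and> x \<in> G i" for x i
    unfolding sub_grading_def by simp
  ultimately show ?thesis
    by (intro hom_lie_superalgebra.intro hom_lie_superalgebra_axioms.intro;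
        (unfold ideal_carrier[OF I])?, (unfold mem)?)
      (blast intro: ideal_subset[OF I] bracket_add_left bracket_add_right
        bracket_scale_left bracket_scale_right twist_add twist_scale bracket_even twist_even
        ideal_bracket_left[OF I] ideal_twist[OF I] super_skew_symmetry hom_super_jacobi)+
qed

section \<open>Twisted adjoint maps and their powers\<close>

lemma ad_apply: "b \<in> L \<Longrightarrow> ad_twisted G bracket \<alpha> x b = bracket x (\<alpha> b)"
  unfolding ad_twisted_def by simp

lemma ad_ideal_apply:
  assumes "hom_lie_ideal scale G bracket \<alpha> I" "b \<in> I"
  shows "ad_twisted (sub_grading G I) bracket \<alpha> x b = bracket x (\<alpha> b)"
  using assms unfolding ad_twisted_def by (simp add: ideal_carrier)

lemma ad_funpow_carrier:
  assumes "x \<in> L" "b \<in> L"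
  shows "(ad_twisted G bracket \<alpha> x ^^ n) b \<in> L"
  using assms by (induction n) (simp_all add: ad_apply bracket_carrier twist_carrier)

text \<open>Needed to compute a power on \<open>c + d\<close> from its values on the two summands.
  Bracket and twist are additive only on the carrier, so the induction relies on the iterates
  remaining there.\<close>

lemma ad_funpow_add:
  assumes "x \<in> L" "b \<in> L" "c \<in> L"
  shows "(ad_twisted G bracket \<alpha> x ^^ n) (b + c)
    = (ad_twisted G bracket \<alpha> x ^^ n) b + (ad_twisted G bracket \<alpha> x ^^ n) c"
  using assms
  by (induction n)
    (simp_all add: ad_apply carrier_add ad_funpow_carrier twist_add twist_carrier bracket_add_right)

end

section \<open>Componentwise calculus in a direct sum of two ideals\<close>

locale hom_lie_ideal_decomposition = hom_lie_superalgebra scale G bracket \<alpha>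
  for scale :: "'f::field \<Rightarrow> 'v::ab_group_add \<Rightarrow> 'v" and G :: "bit \<Rightarrow> 'v set"
    and bracket :: "'v \<Rightarrow> 'v \<Rightarrow> 'v" and \<alpha> :: "'v \<Rightarrow> 'v" +
  fixes U W :: "'v set"
  assumes ideal_U: "hom_lie_ideal scale G bracket \<alpha> U"
    and ideal_W: "hom_lie_ideal scale G bracket \<alpha> W"
    and direct_sum: "is_direct_sum L U W"
begin

text \<open>The setting is symmetric in the two ideals, so one-sided facts are proved for
  \<open>U\<close> alone and transferred to \<open>W\<close> by this lemma.\<close>

lemma decomposition_swap: "hom_lie_ideal_decomposition scale G bracket \<alpha> W U"
proof unfold_locales
  have "{u + w |u w. u \<in> U \<and> w \<in> W} = {w + u |w u. w \<in> W \<and> u \<in> U}"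
    by (metis (no_types, opaque_lifting) add.commute)
  then show "is_direct_sum L W U"
    using direct_sum unfolding is_direct_sum_def by (simp add: Int_commute)
qed (rule ideal_W ideal_U)+

lemma decompose:
  assumes "x \<in> L"
  obtains u w where "x = u + w" "u \<in> U" "w \<in> W"
  using assms direct_sum unfolding is_direct_sum_def by blast

lemma disjoint: "x \<in> U \<Longrightarrow> x \<in> W \<Longrightarrow> x = 0"
  using direct_sum unfolding is_direct_sum_def by blast

lemma components_unique:
  assumes "u + w = u' + w'" "u \<in> U" "u' \<in> U" "w \<in> W" "w' \<in> W"
  shows "u = u'" "w = w'"
proof -
  have eq: "u - u' = w' - w" using assms(1) by (simp add: algebra_simps)
  have "u - u' \<in> U" using assms by (intro subspace_diff[OF ideal_subspace[OF ideal_U]])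
  moreover have "u - u' \<in> W"
    unfolding eq using assms by (intro subspace_diff[OF ideal_subspace[OF ideal_W]])
  ultimately have "u - u' = 0" by (rule disjoint)
  then show "u = u'" "w = w'" using eq by simp_all
qed

text \<open>The bracket lies in \<open>U\<close> by left absorption and in \<open>W\<close> by right
  absorption.\<close>

lemma bracket_cross: "u \<in> U \<Longrightarrow> w \<in> W \<Longrightarrow> bracket u w = 0"
  by (meson disjoint ideal_bracket_left[OF ideal_U] ideal_bracket_right[OF ideal_W]
      ideal_subset[OF ideal_U] ideal_subset[OF ideal_W])

lemma bracket_cross': "u \<in> U \<Longrightarrow> w \<in> W \<Longrightarrow> bracket w u = 0"
  by (rule hom_lie_ideal_decomposition.bracket_cross[OF decomposition_swap])

lemma bracket_component:
  assumes "u \<in> U" "w \<in> W" "b \<in> U"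
  shows "bracket (u + w) b = bracket u b"
  using assms
  by (simp add: bracket_add_left bracket_cross' ideal_subset[OF ideal_U] ideal_subset[OF ideal_W])

lemma bracket_components:
  assumes "u \<in> U" "w \<in> W" "u' \<in> U" "w' \<in> W"
  shows "bracket (u + w) (u' + w') = bracket u u' + bracket w w'"
  using assms
  by (simp add: bracket_add_left bracket_add_right carrier_add bracket_cross bracket_cross'
      ideal_subset[OF ideal_U] ideal_subset[OF ideal_W])

lemma twist_components: "u \<in> U \<Longrightarrow> w \<in> W \<Longrightarrow> \<alpha> (u + w) = \<alpha> u + \<alpha> w"
  by (simp add: twist_add ideal_subset[OF ideal_U] ideal_subset[OF ideal_W])

section \<open>Even fixed points and adjoint powers by components\<close>

lemma even_component:
  assumes "u + w \<in> G 0" "u \<in> U" "w \<in> W"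
  shows "u \<in> G 0"
proof -
  obtain a b where u: "u = a + b" "a \<in> U" "b \<in> U" "a \<in> G 0" "b \<in> G 1"
    using ideal_U \<open>u \<in> U\<close> by (rule idealE)
  obtain c d where w: "w = c + d" "c \<in> W" "d \<in> W" "c \<in> G 0" "d \<in> G 1"
    using ideal_W \<open>w \<in> W\<close> by (rule idealE)
  \<comment> \<open>The total odd part \<open>b + d\<close> is a difference of even elements, hence
    both even and odd, hence zero.\<close>
  have "b + d = (u + w) - (a + c)" using u w by (simp add: algebra_simps)
  also have "\<dots> \<in> G 0"
    by (rule subspace_diff[OF subspace_grade assms(1) subspace_add[OF subspace_grade u(4) w(4)]])
  finally have "b + d \<in> G 0 \<inter> G 1" using u w subspace_add[OF subspace_grade] by blast
  \<comment> \<open>Zero is written as a sum so that uniqueness of components applies and kills the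
    odd part of \<open>u\<close> separately.\<close>
  then have "b + d = 0 + 0" using grade_disjoint by simp
  then have "b = 0"
    using u w subspace_0[OF ideal_subspace[OF ideal_U]] subspace_0[OF ideal_subspace[OF ideal_W]]
    by (intro components_unique(1)[of b d 0 0])
  then show ?thesis using u by simp
qed

text \<open>The twist preserves both ideals, so \<alpha> u and \<alpha> w are the components of the
  twisted sum and can be compared with \<open>u\<close> and \<open>w\<close>.\<close>

lemma even_fixed_points_component:
  assumes "u + w \<in> even_fixed_points G \<alpha>" "u \<in> U" "w \<in> W"
  shows "u \<in> even_fixed_points (sub_grading G U) \<alpha>"
proof -
  have "u + w \<in> G 0" "\<alpha> u + \<alpha> w = u + w"
    using assms by (auto simp: even_fixed_points_def twist_components)
  then have "u \<in> G 0" "\<alpha> u = u"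
    using assms even_component
      components_unique(1)[OF _ ideal_twist[OF ideal_U] _ ideal_twist[OF ideal_W]] by blast+
  then show ?thesis using assms by (simp add: even_fixed_points_def sub_grading_def)
qed

lemma even_fixed_points_sum:
  assumes "u \<in> even_fixed_points (sub_grading G U) \<alpha>" "w \<in> even_fixed_points (sub_grading G W) \<alpha>"
  shows "u + w \<in> even_fixed_points G \<alpha>"
  using assms subspace_add[OF subspace_grade]
  by (auto simp: even_fixed_points_def sub_grading_def twist_components)

text \<open>On arguments from \<open>U\<close> the summand \<open>w\<close> brackets to zero.
  Membership in \<open>U\<close> is carried along in the induction because the next step needs it,
  both for that cancellation and for evaluating the adjoint map of \<open>U\<close>, which is
  \<open>undefined\<close> outside \<open>U\<close>.\<close>

lemma ad_funpow_component:
  assumes "u \<in> U" "w \<in> W" "b \<in> U"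
  shows "(ad_twisted G bracket \<alpha> (u + w) ^^ n) b
      = (ad_twisted (sub_grading G U) bracket \<alpha> u ^^ n) b
    \<and> (ad_twisted (sub_grading G U) bracket \<alpha> u ^^ n) b \<in> U"
  using assms
  by (induction n)
    (simp_all add: ad_apply ad_ideal_apply[OF ideal_U] bracket_component ideal_twist[OF ideal_U]
      ideal_subset[OF ideal_U] ideal_bracket_left[OF ideal_U])

section \<open>Transfer of restrictability between the sum and its summands\<close>

lemma restrictable_component:
  assumes "restrictable scale G bracket \<alpha>"
  shows "restrictable scale (sub_grading G U) bracket \<alpha>"
  unfolding restrictable_def
proof (intro conjI ballI)
  have mult: "multiplicative_hom_lie_superalgebra scale G bracket \<alpha>"
    using assms unfolding restrictable_def by blast
  show "multiplicative_hom_lie_superalgebra scale (sub_grading G U) bracket \<alpha>"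
    using multiplicative_hom_lie_superalgebra.multiplicative[OF mult]
      hom_lie_superalgebra_ideal[OF ideal_U]
    by (simp add: multiplicative_hom_lie_superalgebra_def
        multiplicative_hom_lie_superalgebra_axioms_def ideal_carrier[OF ideal_U]
        ideal_subset[OF ideal_U])
next
  let ?p = "CHAR('f)"
  let ?adU = "ad_twisted (sub_grading G U) bracket \<alpha>"
  fix x assume x: "x \<in> even_fixed_points (sub_grading G U) \<alpha>"
  then have xU: "x \<in> U" and "x \<in> even_fixed_points G \<alpha>"
    by (auto simp: even_fixed_points_def sub_grading_def)
  then obtain y where y: "y \<in> even_fixed_points G \<alpha>"
    and eq: "restrict (ad_twisted G bracket \<alpha> x ^^ ?p) L = ad_twisted G bracket \<alpha> y"
    using assms unfolding restrictable_def by blast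
  have "y \<in> L" using y grade_subset_carrier by (auto simp: even_fixed_points_def)
  \<comment> \<open>The witness \<open>y\<close> need not lie in \<open>U\<close>; its component
    \<open>u\<close> serves as the witness there.\<close>
  then obtain u w where yuw: "y = u + w" "u \<in> U" "w \<in> W" by (rule decompose)
  have "(?adU x ^^ ?p) b = bracket u (\<alpha> b)" if "b \<in> U" for b
  proof -
    \<comment> \<open>Here \<open>x\<close> is regarded as \<open>x + 0\<close>, with zero as its
      component in \<open>W\<close>.\<close>
    have "(?adU x ^^ ?p) b = (ad_twisted G bracket \<alpha> x ^^ ?p) b"
      using ad_funpow_component[OF xU subspace_0[OF ideal_subspace[OF ideal_W]] that] by simp
    also have "\<dots> = bracket y (\<alpha> b)"
      using fun_cong[OF eq, of b] that by (simp add: ideal_subset[OF ideal_U] ad_apply)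
    also have "\<dots> = bracket u (\<alpha> b)"
      using yuw that by (simp add: bracket_component ideal_twist[OF ideal_U])
    finally show ?thesis .
  qed
  \<comment> \<open>Only the adjoint map at \<open>u\<close> is unfolded: both sides are then
    restrictions to \<open>U\<close>, and agreement on \<open>U\<close> suffices.\<close>
  then have "restrict (?adU x ^^ ?p) U = ?adU u"
    unfolding ad_twisted_def[of _ _ _ u] ideal_carrier[OF ideal_U] by (intro restrict_ext)
  moreover have "u \<in> even_fixed_points (sub_grading G U) \<alpha>"
    using y yuw even_fixed_points_component by simp
  ultimately show "restrict (?adU x ^^ ?p) (superspace_carrier (sub_grading G U))
      \<in> ?adU ` even_fixed_points (sub_grading G U) \<alpha>"
    unfolding ideal_carrier[OF ideal_U] by simp
qed

text \<open>Witnesses found separately in \<open>U\<close> and \<open>W\<close> are added.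
  Multiplicativity of the whole algebra also has to be assembled from that of the two
  summands.\<close>

lemma restrictable_sum:
  assumes rU: "restrictable scale (sub_grading G U) bracket \<alpha>"
    and rW: "restrictable scale (sub_grading G W) bracket \<alpha>"
  shows "restrictable scale G bracket \<alpha>"
  unfolding restrictable_def
proof (intro conjI ballI)
  interpret swap: hom_lie_ideal_decomposition scale G bracket \<alpha> W U
    by (rule decomposition_swap)
  show "multiplicative_hom_lie_superalgebra scale G bracket \<alpha>"
  proof unfold_locales
    fix x y assume "x \<in> L" "y \<in> L"
    obtain u w where x: "x = u + w" "u \<in> U" "w \<in> W" using \<open>x \<in> L\<close> by (rule decompose)
    obtain u' w' where y: "y = u' + w'" "u' \<in> U" "w' \<in> W" using \<open>y \<in> L\<close> by (rule decompose)
    have "\<alpha> (bracket u u') = bracket (\<alpha> u) (\<alpha> u')"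
      using rU x y multiplicative_hom_lie_superalgebra.multiplicative ideal_carrier[OF ideal_U]
      unfolding restrictable_def by metis
    moreover have "\<alpha> (bracket w w') = bracket (\<alpha> w) (\<alpha> w')"
      using rW x y multiplicative_hom_lie_superalgebra.multiplicative ideal_carrier[OF ideal_W]
      unfolding restrictable_def by metis
    \<comment> \<open>The mixed brackets vanish before and after twisting, so only the identities
      inside \<open>U\<close> and inside \<open>W\<close> remain.\<close>
    ultimately show "\<alpha> (bracket x y) = bracket (\<alpha> x) (\<alpha> y)"
      using x y
      by (simp add: bracket_components twist_components ideal_bracket_left[OF ideal_U]
          ideal_bracket_left[OF ideal_W] ideal_subset[OF ideal_U] ideal_subset[OF ideal_W]
          ideal_twist[OF ideal_U] ideal_twist[OF ideal_W])
  qed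
  let ?p = "CHAR('f)"
  let ?ad = "ad_twisted G bracket \<alpha>"
  let ?adU = "ad_twisted (sub_grading G U) bracket \<alpha>"
  let ?adW = "ad_twisted (sub_grading G W) bracket \<alpha>"
  fix x assume x: "x \<in> even_fixed_points G \<alpha>"
  then have xL: "x \<in> L" using grade_subset_carrier by (auto simp: even_fixed_points_def)
  then obtain u w where xuw: "x = u + w" "u \<in> U" "w \<in> W" by (rule decompose)
  have "u \<in> even_fixed_points (sub_grading G U) \<alpha>"
    using x xuw even_fixed_points_component by simp
  then obtain u' where u': "u' \<in> even_fixed_points (sub_grading G U) \<alpha>"
    and eqU: "restrict (?adU u ^^ ?p) U = ?adU u'"
    using rU ideal_carrier[OF ideal_U] unfolding restrictable_def by auto
  have "w \<in> even_fixed_points (sub_grading G W) \<alpha>"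
    using x xuw swap.even_fixed_points_component[of w u] by (simp add: add.commute)
  then obtain w' where w': "w' \<in> even_fixed_points (sub_grading G W) \<alpha>"
    and eqW: "restrict (?adW w ^^ ?p) W = ?adW w'"
    using rW ideal_carrier[OF ideal_W] unfolding restrictable_def by auto
  have mem: "u' \<in> U" "w' \<in> W" using u' w' by (auto simp: even_fixed_points_def sub_grading_def)
  \<comment> \<open>Splitting \<open>b\<close> reduces the power to one on \<open>U\<close> governed
    by \<open>u\<close> and one on \<open>W\<close> governed by \<open>w\<close>; the two resulting
    brackets recombine since mixed terms vanish.\<close>
  have "(?ad x ^^ ?p) b = bracket (u' + w') (\<alpha> b)" if "b \<in> L" for b
  proof -
    obtain c d where b: "b = c + d" "c \<in> U" "d \<in> W" using \<open>b \<in> L\<close> by (rule decompose)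
    have "(?ad x ^^ ?p) b = (?ad x ^^ ?p) c + (?ad x ^^ ?p) d"
      using b xL by (simp add: ad_funpow_add ideal_subset[OF ideal_U] ideal_subset[OF ideal_W])
    also have "(?ad x ^^ ?p) c = (?adU u ^^ ?p) c"
      using ad_funpow_component xuw b by simp
    also have "\<dots> = bracket u' (\<alpha> c)"
      using fun_cong[OF eqU, of c] b by (simp add: ad_ideal_apply[OF ideal_U])
    also have "(?ad x ^^ ?p) d = (?adW w ^^ ?p) d"
      using swap.ad_funpow_component[of w u d] xuw b by (simp add: add.commute)
    also have "\<dots> = bracket w' (\<alpha> d)"
      using fun_cong[OF eqW, of d] b by (simp add: ad_ideal_apply[OF ideal_W])
    also have "bracket u' (\<alpha> c) + bracket w' (\<alpha> d) = bracket (u' + w') (\<alpha> b)"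
      using b mem by (simp add: twist_components bracket_components ideal_twist[OF ideal_U]
          ideal_twist[OF ideal_W])
    finally show ?thesis .
  qed
  then have "restrict (?ad x ^^ ?p) L = ?ad (u' + w')"
    unfolding ad_twisted_def[of _ _ _ "u' + w'"] by (intro restrict_ext)
  then show "restrict (?ad x ^^ ?p) L \<in> ?ad ` even_fixed_points G \<alpha>"
    using even_fixed_points_sum[OF u' w'] by simp
qed

end

theorem theorem10:
  fixes scale :: "'f::field \<Rightarrow> 'v::ab_group_add \<Rightarrow> 'v"
    and G :: "bit \<Rightarrow> 'v set"
    and bracket :: "'v \<Rightarrow> 'v \<Rightarrow> 'v"
    and \<alpha> :: "'v \<Rightarrow> 'v"
    and U W :: "'v set"
  assumes "CHAR('f) > 0" "CHAR('f) \<noteq> 2" "CHAR('f) \<noteq> 3"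
    and "hom_lie_superalgebra scale G bracket \<alpha>"
    and "hom_lie_ideal scale G bracket \<alpha> U"
    and "hom_lie_ideal scale G bracket \<alpha> W"
    and "is_direct_sum (superspace_carrier G) U W"
  shows "restrictable scale G bracket \<alpha> \<longleftrightarrow>
    restrictable scale (sub_grading G U) bracket \<alpha> \<and>
    restrictable scale (sub_grading G W) bracket \<alpha>"
proof -
  interpret hom_lie_ideal_decomposition scale G bracket \<alpha> U W
    using assms unfolding hom_lie_ideal_decomposition_def hom_lie_ideal_decomposition_axioms_def
    by blast
  show ?thesis
    \<comment> \<open>Restrictability of \<open>W\<close> is the statement for \<open>U\<close> with
      the two ideals exchanged.\<close>
    using restrictable_component restrictable_sum
      hom_lie_ideal_decomposition.restrictable_component[OF decomposition_swap] by blast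
qed

end
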